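(* Consider the problem $\max\{f(S): S\subseteq N,\ |S|\le k\}$, where $f:2^N\to\mathbb{R}$ is a monotone and subadditive function with $f(\emptyset)=0$ that has a (strong) submodular order, on a ground set $N$ of size $n$, given through a value oracle. For every $\epsilon>0$, no algorithm (deterministic or randomized) that makes at most $\mathrm{poly}(n)$ queries to the value oracle has approximation guarantee better than $0.5+\epsilon$ for this problem.
   Context: $f$ is monotone if $f(A)\ge f(B)$ whenever $B\subseteq A$, and subadditive if $f(A)+f(B)\ge f(A\cup B)$ for all $A,B$. Write $f(X\mid S)=f(X\cup S)-f(S)$. For a permutation $\pi$ of $N$, viewed as a left-to-right ordering, $l_\pi(S)$ and $r_\pi(S)$ denote the leftmost and rightmost elements of $S$. The permutation $\pi$ is a (strong) submodular order for $f$ if $f(C\mid A)\le f(C\mid B)$ for all sets $B\subseteq A$ and every $C$ with $l_\pi(C)>r_\pi(A)$ (comparison of positions in $\pi$; vacuous for empty sets). A value oracle returns $f(S)$ for a queried $S\subseteq N$. The submodular order is regarded as known to the algorithm. An algorithm has approximation guarantee $\alpha$ if on every instance it outputs a set $S$ with $|S|\le k$ and $f(S)\ge\alpha\max_{|T|\le k}f(T)$ (in expectation over its internal randomness if it is randomized). *)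

theory Defs
  imports "HOL-Probability.Probability" "HOL-Computational_Algebra.Polynomial"
begin

section \<open>Submodular orders\<close>

definition monotone_fun :: "'a set \<Rightarrow> ('a set \<Rightarrow> real) \<Rightarrow> bool" where
  "monotone_fun N f \<longleftrightarrow> (\<forall>A B. A \<subseteq> N \<longrightarrow> B \<subseteq> A \<longrightarrow> f A \<ge> f B)"

definition subadditive_fun :: "'a set \<Rightarrow> ('a set \<Rightarrow> real) \<Rightarrow> bool" where
  "subadditive_fun N f \<longleftrightarrow> (\<forall>A B. A \<subseteq> N \<longrightarrow> B \<subseteq> N \<longrightarrow> f A + f B \<ge> f (A \<union> B))"

definition marginal :: "('a set \<Rightarrow> real) \<Rightarrow> 'a set \<Rightarrow> 'a set \<Rightarrow> real" where
  "marginal f X S = f (X \<union> S) - f S"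

text \<open>An ordering of the ground set is given by a function \<open>\<pi>\<close> mapping every element to its
  position, counted from the left.\<close>

definition leftmost :: "('a \<Rightarrow> nat) \<Rightarrow> 'a set \<Rightarrow> 'a" where
  "leftmost \<pi> S = arg_min_on \<pi> S"

definition rightmost :: "('a \<Rightarrow> nat) \<Rightarrow> 'a set \<Rightarrow> 'a" where
  "rightmost \<pi> S = arg_max_on \<pi> S"

text \<open>For empty \<open>A\<close> or \<open>C\<close> the inequality below holds trivially, so
  excluding these cases, where \<open>leftmost\<close> or \<open>rightmost\<close> is unspecified, loses nothing.\<close>

definition submodular_order :: "'a set \<Rightarrow> ('a \<Rightarrow> nat) \<Rightarrow> ('a set \<Rightarrow> real) \<Rightarrow> bool" where
  "submodular_order N \<pi> f \<longleftrightarrow>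
     (\<forall>A B C. A \<subseteq> N \<longrightarrow> B \<subseteq> A \<longrightarrow> C \<subseteq> N \<longrightarrow> A \<noteq> {} \<longrightarrow> C \<noteq> {} \<longrightarrow>
        \<pi> (leftmost \<pi> C) > \<pi> (rightmost \<pi> A) \<longrightarrow> marginal f C A \<le> marginal f C B)"

text \<open>Ground sets of size \<open>n\<close> are labelled \<open>0, \<dots>, n - 1\<close>, so that an ordering
  is a permutation of \<open>{..<n}\<close>. Values of \<open>f\<close> outside the power set of \<open>{..<n}\<close> are
  irrelevant: algorithms may neither query nor output such sets.\<close>

definition so_instance :: "nat \<Rightarrow> (nat \<Rightarrow> nat) \<Rightarrow> (nat set \<Rightarrow> real) \<Rightarrow> bool" where
  "so_instance n \<pi> f \<longleftrightarrow>
     monotone_fun {..<n} f \<and> subadditive_fun {..<n} f \<and> f {} = 0 \<and>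
     \<pi> permutes {..<n} \<and> submodular_order {..<n} \<pi> f"

definition opt :: "nat \<Rightarrow> nat \<Rightarrow> (nat set \<Rightarrow> real) \<Rightarrow> real" where
  "opt n k f = Max (f ` {T. T \<subseteq> {..<n} \<and> card T \<le> k})"


section \<open>Algorithms with access to a value oracle\<close>

text \<open>An adaptive strategy either stops with an output set, or queries a set and continues
  depending on the value returned. There is no restriction on the computation between queries.\<close>

datatype 'a strategy = Output "'a set" | Query "'a set" "real \<Rightarrow> 'a strategy"

primrec result :: "'a strategy \<Rightarrow> ('a set \<Rightarrow> real) \<Rightarrow> 'a set" where
  "result (Output S) f = S"
| "result (Query S c) f = result (c (f S)) f"

primrec queries :: "'a strategy \<Rightarrow> ('a set \<Rightarrow> real) \<Rightarrow> 'a set list" where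
  "queries (Output S) f = []"
| "queries (Query S c) f = S # queries (c (f S)) f"

text \<open>An algorithm receives \<open>n\<close>, \<open>k\<close> and the submodular order \<open>\<pi>\<close> as explicit input;
  the function \<open>f\<close> is accessible only through queries.\<close>

type_synonym algorithm = "nat \<Rightarrow> nat \<Rightarrow> (nat \<Rightarrow> nat) \<Rightarrow> nat strategy"

definition queries_at_most :: "algorithm \<Rightarrow> (nat \<Rightarrow> real) \<Rightarrow> bool" where
  "queries_at_most A q \<longleftrightarrow>
     (\<forall>n k \<pi> f. so_instance n \<pi> f \<longrightarrow>
        (\<forall>S \<in> set (queries (A n k \<pi>) f). S \<subseteq> {..<n}) \<and>
        real (length (queries (A n k \<pi>) f)) \<le> q n)"

definition feasible :: "algorithm \<Rightarrow> bool" where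
  "feasible A \<longleftrightarrow>
     (\<forall>n k \<pi> f. so_instance n \<pi> f \<longrightarrow>
        result (A n k \<pi>) f \<subseteq> {..<n} \<and> card (result (A n k \<pi>) f) \<le> k)"

definition poly_query :: "algorithm \<Rightarrow> bool" where
  "poly_query A \<longleftrightarrow> (\<exists>p :: real poly. queries_at_most A (\<lambda>n. poly p (real n)))"

definition guarantee :: "algorithm \<Rightarrow> real \<Rightarrow> bool" where
  "guarantee A \<alpha> \<longleftrightarrow>
     feasible A \<and>
     (\<forall>n k \<pi> f. so_instance n \<pi> f \<longrightarrow> f (result (A n k \<pi>) f) \<ge> \<alpha> * opt n k f)"

text \<open>A randomized algorithm is a family of deterministic algorithms indexed by a random seed
  drawn from a probability space \<open>M\<close>, such that the output on every instance is a random
  variable. The bounds on queries and the feasibility of the output hold for every seed, with one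
  polynomial for all seeds; the value of the output is compared with the optimum in expectation.\<close>

definition randomized_algorithm :: "'r measure \<Rightarrow> ('r \<Rightarrow> algorithm) \<Rightarrow> bool" where
  "randomized_algorithm M R \<longleftrightarrow>
     prob_space M \<and>
     (\<forall>n k \<pi> f. so_instance n \<pi> f \<longrightarrow>
        (\<lambda>\<omega>. result (R \<omega> n k \<pi>) f) \<in> measurable M (count_space UNIV))"

definition rand_poly_query :: "'r measure \<Rightarrow> ('r \<Rightarrow> algorithm) \<Rightarrow> bool" where
  "rand_poly_query M R \<longleftrightarrow>
     (\<exists>p :: real poly. \<forall>\<omega> \<in> space M. queries_at_most (R \<omega>) (\<lambda>n. poly p (real n)))"

definition rand_guarantee :: "'r measure \<Rightarrow> ('r \<Rightarrow> algorithm) \<Rightarrow> real \<Rightarrow> bool" where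
  "rand_guarantee M R \<alpha> \<longleftrightarrow>
     (\<forall>\<omega> \<in> space M. feasible (R \<omega>)) \<and>
     (\<forall>n k \<pi> f. so_instance n \<pi> f \<longrightarrow>
        prob_space.expectation M (\<lambda>\<omega>. f (result (R \<omega> n k \<pi>) f)) \<ge> \<alpha> * opt n k f)"

end

theory Submission
  imports Defs
begin

text \<open>
  The obstruction is a needle in a haystack. Order \<open>M\<close> interchangeable elements first and one heavy
  element \<open>M\<close> last, and hide a set \<open>D\<close> of \<open>m\<close> light elements. A light element contributes \<open>1\<close>. The
  heavy one contributes \<open>m\<close>, less one unit for every light element that was chosen outside \<open>D\<close>, but never
  less than nothing.
  With \<open>k = m + 1\<close> the solution \<open>D \<union> {M}\<close> is worth \<open>2m\<close>, whereas somebody who chooses light elements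
  without knowing \<open>D\<close> loses at the heavy element what was gained before, and ends up with about
  \<open>m\<close>. Light elements alone give at most \<open>m + 1\<close>. Only the last element of the order has a marginal
  value that varies, and this value only decreases as more light elements are chosen, so the
  identity is a submodular order. It is crucial that the heavy element is a single one: it
  takes just one unit of the budget, which leaves no room to profit from more than \<open>m\<close> light
  elements.

  To make \<open>D\<close> invisible, the first \<open>r\<close> light elements are never charged
  (\<open>excess\<close>). A query then reveals something about \<open>D\<close> only if it meets \<open>D\<close> in at least \<open>r\<close>
  elements. Moreover it must contain fewer than \<open>2m\<close> light elements, since beyond that number the
  heavy element is worthless for every \<open>D\<close> (\<open>hidden_fun_eq_if_not_detects\<close>). The price of the free
  elements is that an uninformed solution may reach \<open>m + r\<close>.

  For constant \<open>m\<close> and \<open>r\<close>, a fixed query detects a fraction of only \<open>O(1 / M ^ r)\<close> of all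
  candidates \<open>D\<close> (\<open>card_detected_le\<close>). Taking \<open>r\<close> larger than the degree of the query bound, then
  \<open>m \<ge> r / \<epsilon>\<close>, and finally \<open>M\<close> large, all queries together detect a negligible fraction of the candidates.
  For every other \<open>D\<close> the algorithm behaves as on \<open>D = {}\<close>, so its value averaged over \<open>D\<close> is at most
  \<open>(1 / 2 + \<epsilon>) \<cdot> 2m\<close> (\<open>hidden_average_bound\<close>). The instances do not depend on the algorithm, only on
  the query bound and \<open>\<epsilon>\<close>. Hence the estimate may be averaged over the seeds of a
  randomized algorithm, as in Yao's principle; deterministic algorithms are the case of a single
  seed.
\<close>

section \<open>Strategies and orders\<close>

text \<open>By induction along the run: each answer, and hence the continuation, is the same for both
  functions.\<close>

lemma result_eq_if_queries_agree:
  assumes "\<And>S. S \<in> set (queries t f) \<Longrightarrow> f S = g S"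
  shows "result t g = result t f"
  using assms by (induction t) auto

text \<open>For the natural order, the condition on the leftmost element of \<open>C\<close> and the rightmost of \<open>A\<close>
  amounts to a pointwise comparison.\<close>

lemma submodular_order_idI:
  assumes "finite N"
    and step: "\<And>A B C. A \<subseteq> N \<Longrightarrow> B \<subseteq> A \<Longrightarrow> C \<subseteq> N \<Longrightarrow> C \<noteq> {} \<Longrightarrow>
      (\<And>a c. a \<in> A \<Longrightarrow> c \<in> C \<Longrightarrow> a < c) \<Longrightarrow> marginal f C A \<le> marginal f C B"
  shows "submodular_order N id (f :: nat set \<Rightarrow> real)"
  unfolding submodular_order_def
proof (intro allI impI)
  fix A B C :: "nat set"
  assume sub: "A \<subseteq> N" "B \<subseteq> A" "C \<subseteq> N" "A \<noteq> {}" "C \<noteq> {}"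
    and less: "id (rightmost id A) < id (leftmost id C)"
  have fin: "finite A" "finite C" using sub assms(1) finite_subset by blast+
  have "a < c" if "a \<in> A" "c \<in> C" for a c
  proof -
    have "\<forall>y. y \<in> A \<longrightarrow> id y < Suc (Max A)"
      using fin by (simp add: less_Suc_eq_le)
    then have "id a \<le> id (rightmost id A)"
      unfolding rightmost_def arg_max_on_def using that(1) by (rule arg_max_nat_le[rotated])
    moreover have "id (leftmost id C) \<le> id c"
      unfolding leftmost_def using fin sub that(2) by (intro arg_min_least)
    ultimately show ?thesis using less by simp
  qed
  then show "marginal f C A \<le> marginal f C B" using sub by (intro step) auto
qed

section \<open>The hard instances\<close>

text \<open>The number of chosen light elements that are charged to the heavy one. Up to \<open>r\<close> elements are
  free regardless of \<open>D\<close>; a larger number is free only if they belong to \<open>D\<close>. Subtraction is truncated, as it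
  is in the tail of \<open>hidden_fun\<close>.\<close>

definition excess :: "nat \<Rightarrow> nat set \<Rightarrow> nat set \<Rightarrow> nat" where
  "excess r D X = card X - max r (card (X \<inter> D))"

definition hidden_fun :: "nat \<Rightarrow> nat \<Rightarrow> nat \<Rightarrow> nat set \<Rightarrow> nat set \<Rightarrow> real" where
  "hidden_fun M m r D S =
     real (card (S \<inter> {..<M})) + (if M \<in> S then real (m - excess r D (S \<inter> {..<M})) else 0)"

text \<open>Monotonicity makes the marginal value of the heavy element decreasing. The Lipschitz bound
  says that an additional light element is charged at most the unit that it contributes itself,
  which keeps \<open>hidden_fun\<close> monotone.\<close>

lemma excess_mono_lipschitz:
  assumes "X \<subseteq> Y" "finite Y"
  shows "excess r D X \<le> excess r D Y" "excess r D Y + card X \<le> excess r D X + card Y"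
proof -
  have fin: "finite X" using assms finite_subset by blast
  have Y: "card Y = card X + card (Y - X)"
    using assms fin by (metis add_diff_inverse_nat card_Diff_subset card_mono not_le)
  have "Y \<inter> D \<subseteq> (X \<inter> D) \<union> (Y - X)" by auto
  then have "card (Y \<inter> D) \<le> card ((X \<inter> D) \<union> (Y - X))" using assms fin by (intro card_mono) auto
  also have "\<dots> \<le> card (X \<inter> D) + card (Y - X)" by (rule card_Un_le)
  finally have 1: "card (Y \<inter> D) \<le> card (X \<inter> D) + card (Y - X)" .
  have 2: "card (X \<inter> D) \<le> card (Y \<inter> D)" using assms by (intro card_mono) auto
  have 3: "card (X \<inter> D) \<le> card X" using fin by (intro card_mono) auto
  show "excess r D X \<le> excess r D Y" using 1 Y unfolding excess_def by linarith
  show "excess r D Y + card X \<le> excess r D X + card Y" 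
    using 2 3 Y unfolding excess_def by linarith
qed

text \<open>The light part is modular and the light elements precede the heavy one, so everything depends on
  the tail, that is, on the value of the heavy element: it is nonnegative and antitone in
  the light elements. The set \<open>D\<close> is arbitrary; in particular the case \<open>D = {}\<close>, on which nothing is
  hidden, is an instance as well.\<close>

lemma so_instance_hidden_fun: "so_instance (Suc M) id (hidden_fun M m r D)"
proof -
  let ?f = "hidden_fun M m r D" and ?N = "{..<Suc M}"
  define I where "I = {..<M}"
  define tail where "tail X = m - excess r D X" for X
  have f: "?f S = real (card (S \<inter> I)) + (if M \<in> S then real (tail (S \<inter> I)) else 0)" for S
    by (simp add: hidden_fun_def I_def tail_def)
  have fin: "finite (S \<inter> I)" for S by (simp add: I_def)
  have tail_antimono: "tail Y \<le> tail X" if "X \<subseteq> Y" "finite Y" for X Y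
    using excess_mono_lipschitz(1)[OF that, of r D] by (simp add: tail_def)
  have "?f B \<le> ?f A" if "B \<subseteq> A" for A B
  proof -
    have sub: "B \<inter> I \<subseteq> A \<inter> I" using that by auto
    note e = excess_mono_lipschitz(2)[OF sub fin, of r D]
    have c: "card (B \<inter> I) \<le> card (A \<inter> I)" by (intro card_mono fin sub)
    have "card (B \<inter> I) + tail (B \<inter> I) \<le> card (A \<inter> I) + tail (A \<inter> I)"
      unfolding tail_def using e c by linarith
    then show ?thesis using that c by (auto simp: f simp flip: of_nat_add)
  qed
  moreover have "?f (A \<union> B) \<le> ?f A + ?f B" for A B
  proof -
    have c: "card ((A \<union> B) \<inter> I) \<le> card (A \<inter> I) + card (B \<inter> I)"
      by (metis Int_Un_distrib2 card_Un_le)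
    have "tail ((A \<union> B) \<inter> I) \<le> tail (A \<inter> I)" "tail ((A \<union> B) \<inter> I) \<le> tail (B \<inter> I)"
      by (intro tail_antimono fin; auto)+
    then show ?thesis using c by (auto simp: f simp flip: of_nat_add)
  qed
  moreover have "?f {} = 0" by (simp add: f)
  moreover have "submodular_order ?N id ?f"
  proof (rule submodular_order_idI)
    fix A B C :: "nat set"
    assume sub: "A \<subseteq> ?N" "B \<subseteq> A" "C \<subseteq> ?N" "C \<noteq> {}"
      and less: "\<And>a c. a \<in> A \<Longrightarrow> c \<in> C \<Longrightarrow> a < c"
    \<comment> \<open>The heavy element comes last, so nothing can follow a set containing it.\<close>
    have M: "M \<notin> A" using sub less by fastforce
    have disj: "C \<inter> A = {}" using less by blast
    have marg: "marginal ?f C X =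
        real (card (C \<inter> I)) + (if M \<in> C then real (tail ((C \<union> X) \<inter> I)) else 0)"
      if "X \<subseteq> A" for X
    proof -
      have "(C \<union> X) \<inter> I = (C \<inter> I) \<union> (X \<inter> I)" by auto
      then have "card ((C \<union> X) \<inter> I) = card (C \<inter> I) + card (X \<inter> I)"
        using disj that fin by (subst card_Un_disjoint[symmetric]) auto
      then show ?thesis using M that by (auto simp: marginal_def f)
    qed
    have "tail ((C \<union> A) \<inter> I) \<le> tail ((C \<union> B) \<inter> I)"
      using sub by (intro tail_antimono fin) auto
    then show "marginal ?f C A \<le> marginal ?f C B" using sub(2) by (simp add: marg)
  qed simp
  ultimately show ?thesis
    by (simp add: so_instance_def monotone_fun_def subadditive_fun_def)
qed

definition hidden_sets :: "nat \<Rightarrow> nat \<Rightarrow> nat set set" where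
  "hidden_sets M m = {D. D \<subseteq> {..<M} \<and> card D = m}"

lemma card_hidden_sets: "card (hidden_sets M m) = M choose m"
  by (simp add: hidden_sets_def n_subsets)

lemma finite_hidden_sets: "finite (hidden_sets M m)"
  by (simp add: hidden_sets_def)

text \<open>The witness is \<open>D\<close> together with the heavy element, for which nothing is charged.\<close>

lemma opt_hidden_fun_ge:
  assumes "D \<in> hidden_sets M m"
  shows "2 * real m \<le> opt (Suc M) (Suc m) (hidden_fun M m r D)"
proof -
  have D: "D \<subseteq> {..<M}" "card D = m" using assms by (auto simp: hidden_sets_def)
  have "insert M D \<inter> {..<M} = D" using D by auto
  then have "hidden_fun M m r D (insert M D) = 2 * real m"
    using D(2) by (simp add: hidden_fun_def excess_def)
  moreover have "insert M D \<in> {T. T \<subseteq> {..<Suc M} \<and> card T \<le> Suc m}"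
    using D by (auto simp: less_Suc_eq card_insert_if finite_subset)
  ultimately show ?thesis unfolding opt_def
    by (intro Max_ge) (auto simp: image_iff intro!: bexI[of _ "insert M D"] exI[of _ "insert M D"])
qed

text \<open>The sets whose value can betray \<open>D\<close>. With \<open>2m\<close> or more light elements at least \<open>m\<close> of them are
  charged, whatever the \<open>m\<close>-element set \<open>D\<close> is, provided that \<open>r \<le> m\<close>.\<close>

definition detects :: "nat \<Rightarrow> nat \<Rightarrow> nat \<Rightarrow> nat set \<Rightarrow> nat set \<Rightarrow> bool" where
  "detects M m r S D \<longleftrightarrow> card (S \<inter> {..<M}) < 2 * m \<and> r \<le> card (S \<inter> {..<M} \<inter> D)"

lemma hidden_fun_eq_if_not_detects:
  assumes "\<not> detects M m r S D" "r \<le> m" "D \<in> hidden_sets M m"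
  shows "hidden_fun M m r {} S = hidden_fun M m r D S"
proof -
  let ?X = "S \<inter> {..<M}"
  have "card (?X \<inter> D) \<le> m"
    using assms(3) card_mono[of D "?X \<inter> D"] by (auto simp: hidden_sets_def finite_subset)
  then have "m - excess r {} ?X = m - excess r D ?X"
    using assms(1,2) by (auto simp: excess_def detects_def)
  then show ?thesis by (simp add: hidden_fun_def)
qed

lemma card_Int_Suc_le:
  assumes "S \<subseteq> {..<Suc M}" "card S \<le> Suc m"
  shows "card (S \<inter> {..<M}) \<le> (if M \<in> S then m else Suc m)"
proof -
  have fin: "finite S" using assms finite_subset by blast
  show ?thesis
  proof (cases "M \<in> S")
    case True
    then have "card (S \<inter> {..<M}) \<le> card (S - {M})" using fin by (intro card_mono) auto
    also have "\<dots> \<le> m" using True fin assms by simp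
    finally show ?thesis using True by simp
  next
    case False
    have "card (S \<inter> {..<M}) \<le> card S" using fin by (intro card_mono) auto
    then show ?thesis using False assms by simp
  qed
qed

lemma hidden_fun_le:
  assumes "S \<subseteq> {..<Suc M}" "card S \<le> Suc m" "1 \<le> m"
  shows "hidden_fun M m r D S \<le> 2 * real m"
  using card_Int_Suc_le[OF assms(1,2)] assms(3) by (auto simp: hidden_fun_def split: if_splits)

text \<open>If the heavy element is chosen, at most \<open>m\<close> light ones fit into the budget, and all but \<open>r\<close> of
  them are cancelled by the charge. Otherwise up to \<open>m + 1\<close> light ones fit, whence \<open>1 \<le> r\<close>.\<close>

lemma hidden_fun_empty_le:
  assumes "S \<subseteq> {..<Suc M}" "card S \<le> Suc m" "1 \<le> r"
  shows "hidden_fun M m r {} S \<le> real m + real r"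
proof -
  have "card (S \<inter> {..<M}) + (m - (card (S \<inter> {..<M}) - r)) \<le> m + r" if "M \<in> S"
    using card_Int_Suc_le[OF assms(1,2)] that by auto
  then show ?thesis
    using card_Int_Suc_le[OF assms(1,2)] assms(3)
    by (auto simp: hidden_fun_def excess_def simp flip: of_nat_add)
qed

lemma hidden_fun_nonneg: "0 \<le> hidden_fun M m r D S"
  by (simp add: hidden_fun_def)

section \<open>Counting the detected sets\<close>

lemma card_supersets:
  assumes "finite N" "T \<subseteq> N" "card T \<le> m"
  shows "card {D. T \<subseteq> D \<and> D \<subseteq> N \<and> card D = m} = (card N - card T) choose (m - card T)"
proof -
  have fin: "finite T" using assms finite_subset by blast
  have "bij_betw (\<lambda>E. E \<union> T) {E. E \<subseteq> N - T \<and> card E = m - card T}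
     {D. T \<subseteq> D \<and> D \<subseteq> N \<and> card D = m}"
  proof (rule bij_betwI[where g = "\<lambda>D. D - T"])
    show "(\<lambda>E. E \<union> T) \<in> {E. E \<subseteq> N - T \<and> card E = m - card T} \<rightarrow>
        {D. T \<subseteq> D \<and> D \<subseteq> N \<and> card D = m}"
    proof (rule funcsetI)
      fix E assume "E \<in> {E. E \<subseteq> N - T \<and> card E = m - card T}"
      then have E: "E \<subseteq> N - T" "card E = m - card T" by auto
      have "card (E \<union> T) = card E + card T"
        using E(1) fin assms(1) finite_subset[OF E(1)] by (intro card_Un_disjoint) auto
      then show "E \<union> T \<in> {D. T \<subseteq> D \<and> D \<subseteq> N \<and> card D = m}" using E assms by auto
    qed
  qed (use assms fin in \<open>auto simp: card_Diff_subset\<close>)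
  then have "card {D. T \<subseteq> D \<and> D \<subseteq> N \<and> card D = m} =
      card {E. E \<subseteq> N - T \<and> card E = m - card T}"
    by (simp add: bij_betw_same_card)
  also have "\<dots> = card (N - T) choose (m - card T)" using assms by (intro n_subsets) auto
  finally show ?thesis using assms fin by (simp add: card_Diff_subset)
qed

text \<open>Union bound over the \<open>r\<close>-element subsets of \<open>X\<close> that \<open>D\<close> may contain.\<close>

lemma card_large_intersection:
  assumes "finite N" "X \<subseteq> N" "r \<le> m"
  shows "card {D. D \<subseteq> N \<and> card D = m \<and> r \<le> card (X \<inter> D)}
    \<le> 2 ^ card X * ((card N - r) choose (m - r))"
proof -
  let ?T = "{T. T \<subseteq> X \<and> card T = r}" and ?U = "\<lambda>T. {D. T \<subseteq> D \<and> D \<subseteq> N \<and> card D = m}"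
  have finX: "finite X" using assms finite_subset by blast
  have "{D. D \<subseteq> N \<and> card D = m \<and> r \<le> card (X \<inter> D)} \<subseteq> (\<Union>T\<in>?T. ?U T)"
  proof (rule subsetI)
    fix D assume "D \<in> {D. D \<subseteq> N \<and> card D = m \<and> r \<le> card (X \<inter> D)}"
    then have D: "D \<subseteq> N" "card D = m" "r \<le> card (X \<inter> D)" by auto
    then obtain T where "T \<subseteq> X \<inter> D" "card T = r" by (meson obtain_subset_with_card_n)
    then show "D \<in> (\<Union>T\<in>?T. ?U T)" using D by auto
  qed
  then have "card {D. D \<subseteq> N \<and> card D = m \<and> r \<le> card (X \<inter> D)} \<le> card (\<Union>T\<in>?T. ?U T)"
    using assms(1) finX by (intro card_mono) auto
  also have "\<dots> \<le> (\<Sum>T\<in>?T. card (?U T))" using finX by (intro card_UN_le) auto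
  also have "\<dots> = (\<Sum>T\<in>?T. (card N - r) choose (m - r))"
    using assms by (intro sum.cong) (auto simp: card_supersets)
  also have "\<dots> = (card X choose r) * ((card N - r) choose (m - r))"
    using finX by (simp add: n_subsets)
  also have "\<dots> \<le> 2 ^ card X * ((card N - r) choose (m - r))"
    by (intro mult_right_mono binomial_le_pow2) auto
  finally show ?thesis .
qed

text \<open>The fraction of the \<open>m\<close>-element subsets that contain \<open>r\<close> given elements is
  \<open>(m choose r) / (M choose r)\<close>, which is a constant times \<open>1 / M ^ r\<close> when \<open>m\<close> and \<open>r\<close> are constant.\<close>

lemma shifted_choose_le:
  assumes "r \<le> m" "m \<le> M" "1 \<le> r"
  shows "real ((M - r) choose (m - r)) \<le> real (M choose m) * (2 ^ m * real r ^ r / real M ^ r)"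
proof -
  have "real ((M - r) choose (m - r)) * (real M / real r) ^ r
      \<le> real ((M - r) choose (m - r)) * real (M choose r)"
    using assms by (intro mult_left_mono binomial_ge_n_over_k_pow_k) auto
  also have "\<dots> = real (M choose m) * real (m choose r)"
    using choose_mult[OF assms(1,2)] by (metis mult.commute of_nat_mult)
  also have "\<dots> \<le> real (M choose m) * 2 ^ m"
    using binomial_le_pow2[of m r] by (intro mult_left_mono) (metis of_nat_le_numeral_power_cancel_iff, simp)
  finally show ?thesis using assms by (simp add: field_simps)
qed

text \<open>The factor \<open>8 ^ m\<close> consists of \<open>4 ^ m\<close> for the subsets of a query with fewer than \<open>2m\<close> light
  elements and \<open>2 ^ m\<close> from \<open>shifted_choose_le\<close>.\<close>

lemma card_detected_le:
  assumes "finite Q" "r \<le> m" "m \<le> M" "1 \<le> r"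
  shows "real (card {D \<in> hidden_sets M m. \<exists>S\<in>Q. detects M m r S D})
    \<le> real (M choose m) * (real (card Q) * (8 ^ m * real r ^ r / real M ^ r))"
proof -
  define b where "b = (M - r) choose (m - r)"
  let ?B = "\<lambda>S. {D \<in> hidden_sets M m. detects M m r S D}"
  have B: "card (?B S) \<le> 4 ^ m * b" for S
  proof (cases "card (S \<inter> {..<M}) < 2 * m")
    case True
    then have "card (?B S) \<le> 2 ^ card (S \<inter> {..<M}) * ((card {..<M} - r) choose (m - r))"
      using card_large_intersection[of "{..<M}" "S \<inter> {..<M}" r m] assms by (simp add: detects_def hidden_sets_def)
    also have "\<dots> \<le> 2 ^ (2 * m) * b"
      unfolding b_def using True by (intro mult_mono power_increasing) auto
    finally show ?thesis by (simp add: power_mult)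
  qed (simp add: detects_def)
  have "{D \<in> hidden_sets M m. \<exists>S\<in>Q. detects M m r S D} = (\<Union>S\<in>Q. ?B S)" by auto
  then have "card {D \<in> hidden_sets M m. \<exists>S\<in>Q. detects M m r S D} 
      \<le> (\<Sum>S\<in>Q. card (?B S))"
    using assms by (simp only: card_UN_le)
  also have "\<dots> \<le> card Q * (4 ^ m * b)" using sum_bounded_above[of Q "\<lambda>S. card (?B S)"] B by simp
  finally have "real (card {D \<in> hidden_sets M m. \<exists>S\<in>Q. detects M m r S D})
      \<le> real (card Q * (4 ^ m * b))" by (simp only: of_nat_le_iff)
  also have "\<dots> = real (card Q) * 4 ^ m * real b" by simp
  also have "\<dots> \<le> real (card Q) * 4 ^ m * (real (M choose m) * (2 ^ m * real r ^ r / real M ^ r))"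
    unfolding b_def using assms by (intro mult_left_mono shifted_choose_le) auto
  also have "\<dots> = real (M choose m) * (real (card Q) * (8 ^ m * real r ^ r / real M ^ r))"
    by (simp add: power_mult_distrib[symmetric] field_simps)
  finally show ?thesis .
qed

section \<open>The average over the hidden set\<close>

definition value_on :: "nat \<Rightarrow> nat \<Rightarrow> nat \<Rightarrow> algorithm \<Rightarrow> nat set \<Rightarrow> real" where
  "value_on M m r A D =
     hidden_fun M m r D (result (A (Suc M) (Suc m) id) (hidden_fun M m r D))"

lemma value_on_le:
  assumes "feasible A" "1 \<le> m"
  shows "value_on M m r A D \<le> 2 * real m"
  using assms so_instance_hidden_fun[of M m r D]
  unfolding value_on_def feasible_def by (intro hidden_fun_le) blast+

text \<open>The transcript on \<open>D = {}\<close> is a fixed list of queries. If none of them detects \<open>D\<close>, and neither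
  does the output, then the algorithm sees the same answers on \<open>D\<close>, and its output has the
  same value as for \<open>D = {}\<close>. The remaining \<open>D\<close> contribute at most the trivial bound \<open>2m\<close>.\<close>

lemma sum_hidden_value_le:
  assumes "feasible A" "queries_at_most A q"
    and "1 \<le> r" "r \<le> m" "m \<le> M"
  shows "(\<Sum>D\<in>hidden_sets M m. value_on M m r A D)
    \<le> real (M choose m) *
       (real m + real r + 2 * real m * ((q (Suc M) + 1) * (8 ^ m * real r ^ r / real M ^ r)))"
proof -
  define f where "f = hidden_fun M m r"
  define t where "t = A (Suc M) (Suc m) id"
  define Ds where "Ds = hidden_sets M m"
  define S0 where "S0 = result t (f {})"
  \<comment> \<open>The output is treated as one more query, since its value must not depend on \<open>D\<close> either.\<close>
  define Q where "Q = insert S0 (set (queries t (f {})))"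
  define Bad where "Bad = {D \<in> hidden_sets M m. \<exists>S\<in>Q. detects M m r S D}"
  define \<rho> where "\<rho> = 8 ^ m * real r ^ r / real M ^ r"
  have inst: "so_instance (Suc M) id (f D)" for D
    unfolding f_def by (rule so_instance_hidden_fun)
  have out: "result t (f D) \<subseteq> {..<Suc M}" "card (result t (f D)) \<le> Suc m" for D
    using assms(1) inst[of D] unfolding feasible_def t_def by blast+
  have len: "real (length (queries t (f {}))) \<le> q (Suc M)"
    using assms(2) inst[of "{}"] unfolding queries_at_most_def t_def by blast
  have "card Q \<le> Suc (length (queries t (f {})))"
    unfolding Q_def by (metis card_insert_le_m1 card_length diff_Suc_1 zero_less_Suc)
  then have cardQ: "real (card Q) \<le> q (Suc M) + 1" using len by linarith
  have finD: "finite Ds" and cardD: "card Ds = M choose m"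
    unfolding Ds_def by (rule finite_hidden_sets, rule card_hidden_sets)
  have value_le: "f D (result t (f D)) \<le> (real m + real r) + (if D \<in> Bad then 2 * real m else 0)"
    if D: "D \<in> Ds" for D
  proof (cases "D \<in> Bad")
    case True
    then show ?thesis
      using hidden_fun_le[where r = r and D = D, OF out[of D]] assms by (simp add: f_def)
  next
    case False
    have eq: "f {} S = f D S" if "S \<in> Q" for S
      using False that D assms unfolding f_def Bad_def Ds_def
      by (intro hidden_fun_eq_if_not_detects) auto
    have "result t (f D) = S0"
      unfolding S0_def by (rule result_eq_if_queries_agree) (simp add: eq Q_def)
    then have "f D (result t (f D)) = f {} S0" using eq[of S0] by (simp add: Q_def)
    also have "\<dots> \<le> real m + real r"
      using out[of "{}"] assms unfolding f_def S0_def by (intro hidden_fun_empty_le) auto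
    finally show ?thesis using False by simp
  qed
  have "(\<Sum>D\<in>Ds. f D (result t (f D)))
      \<le> (\<Sum>D\<in>Ds. (real m + real r) + (if D \<in> Bad then 2 * real m else 0))"
    by (intro sum_mono value_le)
  also have "\<dots> = real (card Ds) * (real m + real r) + 2 * real m * real (card Bad)"
  proof -
    have "Ds \<inter> {D. D \<in> Bad} = Bad" by (auto simp: Bad_def Ds_def)
    then show ?thesis using finD by (simp add: sum.distrib sum.If_cases)
  qed
  also have "\<dots> \<le> real (M choose m) * (real m + real r) +
      2 * real m * (real (M choose m) * ((q (Suc M) + 1) * \<rho>))"
  proof -
    have "real (card Bad) \<le> real (M choose m) * (real (card Q) * \<rho>)"
      unfolding Bad_def \<rho>_def using assms by (intro card_detected_le) (auto simp: Q_def)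
    also have "\<dots> \<le> real (M choose m) * ((q (Suc M) + 1) * \<rho>)"
      using cardQ by (intro mult_left_mono mult_right_mono) (auto simp: \<rho>_def)
    finally show ?thesis unfolding cardD by (intro add_left_mono mult_left_mono) auto
  qed
  also have "\<dots> = real (M choose m) * (real m + real r + 2 * real m * ((q (Suc M) + 1) * \<rho>))"
    by (simp add: algebra_simps)
  finally show ?thesis unfolding f_def t_def Ds_def \<rho>_def value_on_def .
qed

lemma poly_over_power_tendsto_0:
  fixes p :: "real poly"
  assumes "degree p < r"
  shows "(\<lambda>M. (poly p (real (Suc M)) + 1) * (c / real M ^ r)) \<longlonglongrightarrow> 0"
proof -
  define s where "s = (p \<circ>\<^sub>p [:1, 1:] + 1) * [:c:]"
  have "degree s \<le> degree (p \<circ>\<^sub>p [:1, 1:] + 1) + degree [:c:]"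
    unfolding s_def by (rule degree_mult_le)
  also have "\<dots> \<le> degree p" by (auto intro!: degree_add_le simp: degree_pcompose)
  finally have "degree s < degree (monom (1::real) r)" using assms by (simp add: degree_monom_eq)
  then have "((\<lambda>x. poly s x / poly (monom 1 r) x) \<longlongrightarrow> 0) at_infinity"
    by (rule poly_divide_tendsto_0_at_infinity)
  from filterlim_compose[OF this tendsto_of_nat]
  show ?thesis by (simp add: s_def poly_pcompose poly_monom algebra_simps add_divide_distrib)
qed

text \<open>The order of choices matters: \<open>r\<close> depends on the degree of the query bound, \<open>m\<close> on \<open>r\<close> and \<open>\<epsilon>\<close>, and
  \<open>M\<close> on all of them. The slack \<open>2\<epsilon>m\<close> is split evenly between the \<open>r\<close> free elements and the detected
  sets. Neither \<open>M\<close>, \<open>m\<close> nor \<open>r\<close> depends on the algorithm, so that one family of instances defeats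
  all seeds of a randomized algorithm.\<close>

lemma hidden_average_bound:
  fixes p :: "real poly"
  assumes "\<epsilon> > 0"
  shows "\<exists>M m r. 1 \<le> m \<and> m \<le> M \<and>
    (\<forall>A. feasible A \<longrightarrow> queries_at_most A (\<lambda>n. poly p (real n)) \<longrightarrow>
      (\<Sum>D\<in>hidden_sets M m. value_on M m r A D)
      \<le> real (M choose m) * ((1 / 2 + \<epsilon>) * (2 * real m)))"
proof -
  define r where "r = Suc (degree p)"
  define m where "m = max r (nat \<lceil>real r / \<epsilon>\<rceil>)"
  have "real r / \<epsilon> \<le> real m" unfolding m_def by linarith
  then have rm: "real r \<le> \<epsilon> * real m" using assms by (simp add: field_simps)
  have r: "1 \<le> r" "r \<le> m" by (auto simp: r_def m_def)
  have "(\<lambda>M. (poly p (real (Suc M)) + 1) * (8 ^ m * real r ^ r / real M ^ r)) \<longlonglongrightarrow> 0"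
    by (rule poly_over_power_tendsto_0) (simp add: r_def)
  then have "\<forall>\<^sub>F M in sequentially. 
      (poly p (real (Suc M)) + 1) * (8 ^ m * real r ^ r / real M ^ r) < \<epsilon> / 2"
    using assms by (intro order_tendstoD) auto
  then have "\<forall>\<^sub>F M in sequentially. m \<le> M \<and>
      (poly p (real (Suc M)) + 1) * (8 ^ m * real r ^ r / real M ^ r) < \<epsilon> / 2"
    using eventually_ge_at_top by (rule eventually_conj[rotated])
  then obtain M where M: "m \<le> M"
      "(poly p (real (Suc M)) + 1) * (8 ^ m * real r ^ r / real M ^ r) < \<epsilon> / 2"
    by (metis (no_types, lifting) eventually_sequentially order_refl)
  show ?thesis
  proof (intro exI conjI allI impI)
    fix A assume A: "feasible A" "queries_at_most A (\<lambda>n. poly p (real n))"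
    have "real m + real r + 2 * real m * 
        ((poly p (real (Suc M)) + 1) * (8 ^ m * real r ^ r / real M ^ r))
        \<le> real m + \<epsilon> * real m + 2 * real m * (\<epsilon> / 2)"
      using rm M by (intro add_mono mult_left_mono) auto
    also have "\<dots> = (1 / 2 + \<epsilon>) * (2 * real m)" by (simp add: algebra_simps)
    finally show "(\<Sum>D\<in>hidden_sets M m. value_on M m r A D)
      \<le> real (M choose m) * ((1 / 2 + \<epsilon>) * (2 * real m))"
      by (intro order_trans[OF sum_hidden_value_le[OF A r M(1)]] mult_left_mono) auto
  qed (use r M in auto)
qed

section \<open>Deterministic and randomized algorithms\<close>

text \<open>Sum the expected values over all hidden sets and exchange sum and expectation: by the
  guarantee the result is at least \<open>\<alpha> \<cdot> 2m\<close> per hidden set, while \<open>hidden_average_bound\<close> bounds it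
  for each seed separately.\<close>

lemma no_good_randomized_algorithm:
  assumes "\<epsilon> > 0" "randomized_algorithm P R" "rand_poly_query P R" "rand_guarantee P R \<alpha>"
  shows "\<alpha> \<le> 1 / 2 + \<epsilon>"
proof (rule ccontr)
  assume \<alpha>: "\<not> \<alpha> \<le> 1 / 2 + \<epsilon>"
  interpret prob_space P using assms(2) by (simp add: randomized_algorithm_def)
  from assms(3) obtain p where p: "\<And>\<omega>. \<omega> \<in> space P \<Longrightarrow> queries_at_most (R \<omega>) (\<lambda>n. poly p (real n))"
    by (auto simp: rand_poly_query_def)
  have feas: "feasible (R \<omega>)" if "\<omega> \<in> space P" for \<omega>
    using assms(4) that by (simp add: rand_guarantee_def)
  obtain M m r where Mm: "1 \<le> m" "m \<le> M" and bound:
    "\<And>A. feasible A \<Longrightarrow> queries_at_most A (\<lambda>n. poly p (real n)) \<Longrightarrow>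
      (\<Sum>D\<in>hidden_sets M m. value_on M m r A D)
      \<le> real (M choose m) * ((1 / 2 + \<epsilon>) * (2 * real m))"
    using hidden_average_bound[OF assms(1), of p] by blast
  define X where "X D \<omega> = value_on M m r (R \<omega>) D" for D \<omega>
  have int: "integrable P (X D)" for D
  proof (rule integrable_const_bound)
    show "AE \<omega> in P. norm (X D \<omega>) \<le> 2 * real m"
      using feas value_on_le[of _ m M r D] Mm(1)
      by (intro AE_I2) (auto simp: X_def value_on_def hidden_fun_nonneg)
    have "(\<lambda>\<omega>. result (R \<omega> (Suc M) (Suc m) id) (hidden_fun M m r D))
        \<in> measurable P (count_space UNIV)"
      using assms(2) so_instance_hidden_fun by (simp add: randomized_algorithm_def)
    then show "X D \<in> borel_measurable P"
      unfolding X_def value_on_def by (rule measurable_compose) simp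
  qed
  have mean: "\<alpha> * (2 * real m) \<le> expectation (X D)" if D: "D \<in> hidden_sets M m" for D
  proof -
    have "\<alpha> * (2 * real m) \<le> \<alpha> * opt (Suc M) (Suc m) (hidden_fun M m r D)"
      using D \<alpha> assms(1) by (intro mult_left_mono opt_hidden_fun_ge) auto
    also have "\<dots> \<le> expectation (X D)"
      using assms(4) so_instance_hidden_fun[of M m r D]
      unfolding rand_guarantee_def X_def value_on_def by blast
    finally show ?thesis .
  qed
  have "real (M choose m) * (\<alpha> * (2 * real m)) = (\<Sum>D\<in>hidden_sets M m. \<alpha> * (2 * real m))"
    by (simp add: card_hidden_sets)
  also have "\<dots> \<le> (\<Sum>D\<in>hidden_sets M m. expectation (X D))" by (intro sum_mono mean)
  also have "\<dots> = expectation (\<lambda>\<omega>. \<Sum>D\<in>hidden_sets M m. X D \<omega>)"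
    using int by (simp add: integral_sum)
  also have "\<dots> \<le> real (M choose m) * ((1 / 2 + \<epsilon>) * (2 * real m))"
  proof (rule integral_le_const)
    show "integrable P (\<lambda>\<omega>. \<Sum>D\<in>hidden_sets M m. X D \<omega>)" using int by simp
    show "AE \<omega> in P. (\<Sum>D\<in>hidden_sets M m. X D \<omega>) \<le> real (M choose m) * ((1 / 2 + \<epsilon>) * (2 * real m))"
      unfolding X_def using bound feas p by (intro AE_I2) blast
  qed
  finally show False using \<alpha> Mm by simp
qed

lemma no_good_deterministic_algorithm:
  assumes "\<epsilon> > 0" "poly_query A" "guarantee A \<alpha>"
  shows "\<alpha> \<le> 1 / 2 + \<epsilon>"
proof (rule no_good_randomized_algorithm[OF assms(1)])
  define P where "P = return (count_space UNIV) ()"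
  have P: "prob_space P" "space P = UNIV" "sets P = UNIV"
    by (auto simp: P_def prob_space_return)
  show "randomized_algorithm P (\<lambda>_. A)" using P(1) by (simp add: randomized_algorithm_def)
  show "rand_poly_query P (\<lambda>_. A)"
    using assms(2) by (auto simp: rand_poly_query_def poly_query_def)
  show "rand_guarantee P (\<lambda>_. A) \<alpha>"
    using assms(3) prob_space.prob_space[OF P(1)] by (simp add: rand_guarantee_def guarantee_def)
qed

theorem theorem3:
  fixes \<epsilon> :: real
  assumes "\<epsilon> > 0"
  shows "\<not> (\<exists>(A :: algorithm) \<alpha>. poly_query A \<and> guarantee A \<alpha> \<and> \<alpha> > 1 / 2 + \<epsilon>) \<and>
         \<not> (\<exists>(M :: 'r measure) R \<alpha>. randomized_algorithm M R \<and> rand_poly_query M R \<and>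
               rand_guarantee M R \<alpha> \<and> \<alpha> > 1 / 2 + \<epsilon>)"
  using no_good_deterministic_algorithm[OF assms] no_good_randomized_algorithm[OF assms]
  by (meson not_le)

end
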